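(* Let $V$ and $W$ be Banach spaces, and assume that the tensor powers of $V$ are all equipped with admissible norms. Assume that $\Sigma \subset V$ is compact. Let $\varepsilon,\gamma > 0$, with $k \in \mathbb{Z}_{\geq 0}$ such that $\gamma \in (k,k+1]$, $(K_1,K_2) \in (\mathbb{R}_{\geq 0} \times \mathbb{R}_{\geq 0}) \setminus \{(0,0)\}$, and $0 \leq \varepsilon_0 < \min\{K_1+K_2,\varepsilon\}$. Given $l \in \{0,\ldots,k\}$ let $\delta_0 = \delta_0(\varepsilon,\varepsilon_0,K_1+K_2,\gamma,l) > 0$ be the constant $$\delta_0 := \sup\left\{ \theta > 0 : (K_1+K_2)\theta^{\gamma-l} + \varepsilon_0 e^{\theta} \leq \min\{K_1+K_2,\varepsilon\} \right\}.$$ Let $N = N(\Sigma,\varepsilon,\varepsilon_0,K_1+K_2,\gamma,l) \in \mathbb{Z}_{\geq 0}$ denote the $\delta_0$-covering number of $\Sigma$, that is, $$N := \min\left\{ d \in \mathbb{Z}_{\geq 0} : \text{there exist } x_1,\ldots,x_d \in \Sigma \text{ such that } \Sigma \subset \bigcup_{j=1}^d \overline{\mathbb{B}}_V(x_j,\delta_0) \right\}.$$ Then there is a finite subset $\Sigma_N = \{z_1,\ldots,z_N\} \subset \Sigma$ for which the following is true. Let $\psi = (\psi^{(0)},\ldots,\psi^{(k)})$ and $\varphi = (\varphi^{(0)},\ldots,\varphi^{(k)})$ in $\mathrm{Lip}(\gamma,\Sigma,W)$ satisfy $\|\psi\|_{\mathrm{Lip}(\gamma,\Sigma,W)} \leq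 K_1$ and $\|\varphi\|_{\mathrm{Lip}(\gamma,\Sigma,W)} \leq K_2$. Suppose that for every $i \in \{0,\ldots,k\}$ and every $j \in \{1,\ldots,N\}$ we have $$\left\| \psi^{(i)}(z_j) - \varphi^{(i)}(z_j) \right\|_{\mathcal{L}(V^{\otimes i};W)} \leq \varepsilon_0.$$ Then for every $s \in \{0,\ldots,l\}$ and every $x \in \Sigma$ we have $$\left\| \psi^{(s)}(x) - \varphi^{(s)}(x) \right\|_{\mathcal{L}(V^{\otimes s};W)} \leq \varepsilon.$$
   Context: All Banach spaces are real. $\overline{\mathbb{B}}_V(x,r) := \{v \in V : \|v-x\|_V \leq r\}$. Admissible norms: the tensor powers of $V$ are equipped with admissible norms if for each $n \in \mathbb{Z}_{\geq 2}$ the tensor power $V^{\otimes n}$ carries a norm $\|\cdot\|_{V^{\otimes n}}$ (with $V^{\otimes 1} = V$ carrying its own norm) such that: (i) for each $n \geq 1$ the symmetric group $S_n$ acts by isometries on $V^{\otimes n}$, the action being $\rho(a_1 \otimes \cdots \otimes a_n) := a_{\rho(1)} \otimes \cdots \otimes a_{\rho(n)}$ extended linearly; (ii) for all $n,m \geq 1$, $v \in V^{\otimes n}$, $w \in V^{\otimes m}$: $\|v \otimes w\|_{V^{\otimes(n+m)}} \leq \|v\|_{V^{\otimes n}} \|w\|_{V^{\otimes m}}$; (iii) for all $n,m \geq 1$, $\phi \in (V^{\otimes n})^*$, $\sigma \in (V^{\otimes m})^*$: $\|\phi \otimes \sigma\|_{(V^{\otimes (n+m)})^*} \leq \|\phi\|_{(V^{\otimes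 n})^*} \|\sigma\|_{(V^{\otimes m})^*}$, with dual norms. (Having both (ii) and (iii) forces equality in both.) $\mathcal{L}(V^{\otimes l};W)$ is the space of symmetric $l$-linear forms from $V$ to $W$, regarded as a subspace of the linear maps $V^{\otimes l} \to W$, with the operator norm $\|\mathbf{A}\|_{\mathcal{L}(V^{\otimes l};W)} = \sup\{\|\mathbf{A}[v]\|_W : \|v\|_{V^{\otimes l}} = 1\}$. $V^{\otimes 0} := \mathbb{R}$ and $\mathcal{L}(V^{\otimes 0};W) = W$ with norm $\|\cdot\|_W$. $\mathrm{Lip}(\gamma,\Sigma,W)$: let $\Sigma \subset V$ be closed, $\gamma > 0$ and $k \in \mathbb{Z}_{\geq 0}$ with $\gamma \in (k,k+1]$. A collection $\psi = (\psi^{(0)},\ldots,\psi^{(k)})$ of functions $\psi^{(l)} : \Sigma \to \mathcal{L}(V^{\otimes l};W)$ is in $\mathrm{Lip}(\gamma,\Sigma,W)$ if there is $M \geq 0$ such that for all $l \in \{0,\ldots,k\}$ and $x,y \in \Sigma$: (a) $\|\psi^{(l)}(x)\|_{\mathcal{L}(V^{\otimes l};W)} \leq M$; (b) $\|R^\psi_l(x,y)\|_{\mathcal{L}(V^{\otimes l};W)} \leq M\|y-x\|_V^{\gamma-l}$, where for $v \in V^{\otimes l}$ $$R^\psi_l(x,y)[v] := \psi^{(l)}(y)[v] - \sum_{s=0}^{k-l} \frac{1}{s!} \psi^{(l+s)}(x)\left[v \otimes (y-x)^{\otimes s}\right].$$ The norm $\|\psi\|_{\mathrm{Lip}(\gamma,\Sigma,W)}$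 is the smallest such $M$. *)

theory Defs
  imports "HOL-Analysis.Analysis" "HOL-Analysis.Finite_Function_Topology"
    "HOL-Combinatorics.Permutations"
begin

section \<open>Algebraic tensor powers of a real vector space\<close>

text \<open>
  The tensor algebra of \<open>'v\<close>: the free real vector space on words over \<open>'v\<close>, modulo the
  subspace spanned by the multilinearity relations. These relations are homogeneous in the word
  length, so the tensor power of order \<open>n\<close> is the span of the classes of the words of length
  \<open>n\<close>; order \<open>0\<close> is the line spanned by the empty word, i.e. a copy of the reals.
\<close>

definition tensor_relations :: "('v::real_vector list \<Rightarrow>\<^sub>0 real) set" where
  "tensor_relations =
    {Poly_Mapping.single (us @ (a *\<^sub>R x + b *\<^sub>R y) # vs) 1
      - a *\<^sub>R Poly_Mapping.single (us @ x # vs) 1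
      - b *\<^sub>R Poly_Mapping.single (us @ y # vs) 1 | us vs x y a b. True}"

quotient_type (overloaded) 'v tensor = "'v::real_vector list \<Rightarrow>\<^sub>0 real" /
  "\<lambda>p q. p - q \<in> span tensor_relations"
proof (rule equivpI)
  show "reflp (\<lambda>p q. p - q \<in> span (tensor_relations :: ('v list \<Rightarrow>\<^sub>0 real) set))"
    by (simp add: reflp_def span_zero)
  show "symp (\<lambda>p q. p - q \<in> span (tensor_relations :: ('v list \<Rightarrow>\<^sub>0 real) set))"
    by (rule sympI) (metis minus_diff_eq span_neg)
  show "transp (\<lambda>p q. p - q \<in> span (tensor_relations :: ('v list \<Rightarrow>\<^sub>0 real) set))"
  proof (rule transpI)
    fix p q r :: "'v list \<Rightarrow>\<^sub>0 real"
    assume "p - q \<in> span tensor_relations" "q - r \<in> span tensor_relations"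
    from span_add[OF this] show "p - r \<in> span tensor_relations" by simp
  qed
qed

instantiation tensor :: (real_vector) real_vector
begin

lift_definition zero_tensor :: "'a tensor" is 0 .

lift_definition plus_tensor :: "'a tensor \<Rightarrow> 'a tensor \<Rightarrow> 'a tensor" is "(+)"
proof -
  fix p p' q q' :: "'a list \<Rightarrow>\<^sub>0 real"
  assume "p - p' \<in> span tensor_relations" "q - q' \<in> span tensor_relations"
  from span_add[OF this] show "(p + q) - (p' + q') \<in> span tensor_relations"
    by (simp add: algebra_simps)
qed

lift_definition minus_tensor :: "'a tensor \<Rightarrow> 'a tensor \<Rightarrow> 'a tensor" is "(-)"
proof -
  fix p p' q q' :: "'a list \<Rightarrow>\<^sub>0 real"
  assume "p - p' \<in> span tensor_relations" "q - q' \<in> span tensor_relations"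
  from span_diff[OF this] show "(p - q) - (p' - q') \<in> span tensor_relations"
    by (simp add: algebra_simps)
qed

lift_definition uminus_tensor :: "'a tensor \<Rightarrow> 'a tensor" is uminus
  by (subst minus_diff_minus) (rule span_neg)

lift_definition scaleR_tensor :: "real \<Rightarrow> 'a tensor \<Rightarrow> 'a tensor" is scaleR
  by (subst scaleR_right_diff_distrib[symmetric]) (rule span_scale)

instance
  by standard (transfer; simp add: algebra_simps span_zero)+

end

lift_definition pure_tensor :: "'v::real_vector list \<Rightarrow> 'v tensor" is
  "\<lambda>vs. Poly_Mapping.single vs 1" .

definition tensor_power :: "nat \<Rightarrow> 'v::real_vector tensor set" where
  "tensor_power n = span (pure_tensor ` {vs. length vs = n})"

definition multilinear :: "('v::real_vector list \<Rightarrow> 'w::real_vector) \<Rightarrow> bool" where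
  "multilinear f \<longleftrightarrow> (\<forall>us vs. linear (\<lambda>x. f (us @ x # vs)))"

definition free_extension :: "('b \<Rightarrow> 'w::real_vector) \<Rightarrow> ('b \<Rightarrow>\<^sub>0 real) \<Rightarrow> 'w" where
  "free_extension f p = (\<Sum>b\<in>Poly_Mapping.keys p. Poly_Mapping.lookup p b *\<^sub>R f b)"

lemma lookup_scaleR [simp]:
  "Poly_Mapping.lookup (c *\<^sub>R p) b = c *\<^sub>R Poly_Mapping.lookup (p :: 'b \<Rightarrow>\<^sub>0 real) b"
  by (simp add: scaleR_poly_mapping_def)

lemma free_extension_superset:
  assumes "finite A" "Poly_Mapping.keys p \<subseteq> A"
  shows "free_extension f p = (\<Sum>b\<in>A. Poly_Mapping.lookup p b *\<^sub>R f b)"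
  unfolding free_extension_def
  by (rule sum.mono_neutral_left) (use assms in \<open>auto simp: in_keys_iff\<close>)

lemma linear_free_extension: "linear (free_extension f)"
proof (rule linearI)
  fix p q :: "'a \<Rightarrow>\<^sub>0 real" and c :: real
  let ?A = "Poly_Mapping.keys p \<union> Poly_Mapping.keys q"
  show "free_extension f (p + q) = free_extension f p + free_extension f q"
    using keys_add[of p q]
    by (simp add: free_extension_superset[of ?A] lookup_add scaleR_left_distrib sum.distrib)
  have "Poly_Mapping.keys (c *\<^sub>R p) \<subseteq> Poly_Mapping.keys p"
    by (auto simp: in_keys_iff)
  then show "free_extension f (c *\<^sub>R p) = c *\<^sub>R free_extension f p"
    by (simp add: free_extension_superset[of "Poly_Mapping.keys p"] scaleR_sum_right)
qed

lemma free_extension_single [simp]: "free_extension f (Poly_Mapping.single b 1) = f b"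
  by (simp add: free_extension_def)

lemma free_extension_relations:
  assumes "multilinear f" "p \<in> span tensor_relations"
  shows "free_extension f p = 0"
  using assms(2)
proof (induction rule: span_induct)
  case base
  show ?case
    by (auto simp: subspace_def linear_free_extension linear_0 linear_add linear_cmul)
next
  case (step p)
  then obtain us vs x y a b where
    "p = Poly_Mapping.single (us @ (a *\<^sub>R x + b *\<^sub>R y) # vs) 1
      - a *\<^sub>R Poly_Mapping.single (us @ x # vs) 1
      - b *\<^sub>R Poly_Mapping.single (us @ y # vs) 1"
    unfolding tensor_relations_def by blast
  moreover have "linear (\<lambda>x. f (us @ x # vs))"
    using assms(1) by (simp add: multilinear_def)
  then have "f (us @ (a *\<^sub>R x + b *\<^sub>R y) # vs) = a *\<^sub>R f (us @ x # vs) + b *\<^sub>R f (us @ y # vs)"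
    by (simp add: linear_add[of "\<lambda>x. f (us @ x # vs)"] linear_cmul[of "\<lambda>x. f (us @ x # vs)"])
  ultimately show ?case
    by (simp add: linear_diff[OF linear_free_extension] linear_cmul[OF linear_free_extension])
qed

text \<open>The linear map on the tensor algebra induced by a map that is multilinear on words
  (the value \<open>0\<close> for other maps is a dummy).\<close>

lift_definition tensor_lift ::
  "('v::real_vector list \<Rightarrow> 'w::real_vector) \<Rightarrow> 'v tensor \<Rightarrow> 'w" is
  "\<lambda>f p. if multilinear f then free_extension f p else 0"
proof -
  fix f :: "'v list \<Rightarrow> 'w" and p q :: "'v list \<Rightarrow>\<^sub>0 real"
  assume "p - q \<in> span tensor_relations"
  then show "(if multilinear f then free_extension f p else 0)
      = (if multilinear f then free_extension f q else 0)"
    using free_extension_relations[of f "p - q"] by (simp add: linear_diff[OF linear_free_extension])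
qed

lemma linear_tensor_lift: "linear (tensor_lift f)"
  by (rule linearI; transfer;
      simp add: linear_add[OF linear_free_extension] linear_cmul[OF linear_free_extension])

lemma tensor_lift_pure: "multilinear f \<Longrightarrow> tensor_lift f (pure_tensor vs) = f vs"
  by transfer simp

lemma span_pure_tensor: "span (range pure_tensor) = UNIV"
proof -
  have "t \<in> span (range pure_tensor)" for t :: "'v::real_vector tensor"
  proof -
    have *: "abs_tensor (\<Sum>b\<in>A. c b *\<^sub>R Poly_Mapping.single b 1) = (\<Sum>b\<in>A. c b *\<^sub>R pure_tensor b)"
      if "finite A" for A and c :: "'v list \<Rightarrow> real"
      using that
    proof (induction A rule: finite_induct)
      case empty
      show ?case by (simp add: zero_tensor_def)
    next
      case (insert b A)
      then show ?case
        by (simp add: plus_tensor.abs_eq[symmetric] scaleR_tensor.abs_eq[symmetric] pure_tensor.abs_eq)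
    qed
    obtain p where "t = abs_tensor p"
      using Quotient3_abs_rep[OF Quotient3_tensor, of t] by metis
    moreover have "p = (\<Sum>b\<in>Poly_Mapping.keys p. Poly_Mapping.lookup p b *\<^sub>R Poly_Mapping.single b 1)"
      by (rule poly_mapping_eqI)
        (auto simp: lookup_sum lookup_single when_def in_keys_iff if_distrib sum.delta cong: if_cong)
    ultimately have "t = (\<Sum>b\<in>Poly_Mapping.keys p. Poly_Mapping.lookup p b *\<^sub>R pure_tensor b)"
      using * finite_keys by metis
    then show ?thesis
      by (simp only:) (intro span_sum span_scale span_base rangeI)
  qed
  then show ?thesis by blast
qed

lemma pure_tensor_relation:
  fixes us vs :: "'v::real_vector list"
  shows "pure_tensor (us @ (a *\<^sub>R x + b *\<^sub>R y) # vs)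
      = a *\<^sub>R pure_tensor (us @ x # vs) + b *\<^sub>R pure_tensor (us @ y # vs)"
proof (transfer, unfold diff_diff_add[symmetric], rule span_base)
  fix us vs :: "'v list" and x y a b
  show "Poly_Mapping.single (us @ (a *\<^sub>R x + b *\<^sub>R y) # vs) 1
      - a *\<^sub>R Poly_Mapping.single (us @ x # vs) 1
      - b *\<^sub>R Poly_Mapping.single (us @ y # vs) 1 \<in> tensor_relations"
    unfolding tensor_relations_def by blast
qed

lemma multilinear_pure_tensor: "multilinear pure_tensor"
  unfolding multilinear_def
proof (intro allI linearI)
  fix us vs :: "'v::real_vector list" and x y :: 'v and c :: real
  show "pure_tensor (us @ (x + y) # vs) = pure_tensor (us @ x # vs) + pure_tensor (us @ y # vs)"
    using pure_tensor_relation[of us 1 x 1 y vs] by simp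
  show "pure_tensor (us @ (c *\<^sub>R x) # vs) = c *\<^sub>R pure_tensor (us @ x # vs)"
    using pure_tensor_relation[of us c x 0 x vs] by simp
qed

lemma linear_pure_tensor: "linear (\<lambda>x. pure_tensor (us @ x # vs))"
  using multilinear_pure_tensor unfolding multilinear_def by blast

definition tensor_mult :: "'v::real_vector tensor \<Rightarrow> 'v tensor \<Rightarrow> 'v tensor" (infixr \<open>\<otimes>\<^sub>T\<close> 70) where
  "s \<otimes>\<^sub>T t = tensor_lift (\<lambda>us. tensor_lift (\<lambda>vs. pure_tensor (us @ vs)) t) s"

text \<open>The action of a permutation of the index set \<open>{..<n}\<close> on the tensor power of order \<open>n\<close>;
  the other homogeneous components are left fixed.\<close>

definition tensor_permute :: "nat \<Rightarrow> (nat \<Rightarrow> nat) \<Rightarrow> 'v::real_vector tensor \<Rightarrow> 'v tensor" where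
  "tensor_permute n \<rho> =
    tensor_lift (\<lambda>vs. pure_tensor (if length vs = n then permute_list \<rho> vs else vs))"

definition tensor_functional ::
  "nat \<Rightarrow> nat \<Rightarrow> ('v::real_vector tensor \<Rightarrow> real) \<Rightarrow> ('v tensor \<Rightarrow> real) \<Rightarrow> 'v tensor \<Rightarrow> real" where
  "tensor_functional n m \<phi> \<sigma> =
    tensor_lift (\<lambda>vs. if length vs = n + m
      then \<phi> (pure_tensor (take n vs)) * \<sigma> (pure_tensor (drop n vs)) else 0)"

text \<open>Maps out of the tensor power of order \<open>n\<close> are total functions on the tensor algebra;
  only their values on that subspace are ever used.\<close>

definition linear_on_power :: "nat \<Rightarrow> ('v::real_vector tensor \<Rightarrow> 'w::real_vector) \<Rightarrow> bool" where
  "linear_on_power n A \<longleftrightarrow>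
    (\<forall>s\<in>tensor_power n. \<forall>t\<in>tensor_power n. A (s + t) = A s + A t) \<and>
    (\<forall>c. \<forall>t\<in>tensor_power n. A (c *\<^sub>R t) = c *\<^sub>R A t)"

lemma
  fixes s t :: "'a::real_vector tensor" and us vs :: "'a list"
  shows tensor_mult_pure: "pure_tensor us \<otimes>\<^sub>T pure_tensor vs = pure_tensor (us @ vs)"
  and linear_tensor_mult_left: "linear (\<lambda>s. s \<otimes>\<^sub>T t)"
  and linear_tensor_mult_right: "linear (\<lambda>t. s \<otimes>\<^sub>T t)"
proof -
  have right: "multilinear (\<lambda>vs. pure_tensor (us @ vs :: 'a list))" for us
    unfolding multilinear_def by (simp only: append_assoc[symmetric] linear_pure_tensor simp_thms)
  have left: "multilinear (\<lambda>us. tensor_lift (\<lambda>vs. pure_tensor (us @ vs :: 'a list)) t)" for t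
    unfolding multilinear_def
  proof (intro allI)
    fix us ws
    let ?F = "\<lambda>t x. tensor_lift (\<lambda>vs. pure_tensor ((us @ x # ws) @ vs)) t :: 'a tensor"
    have lin: "linear (?F t)" if "t \<in> span (range pure_tensor)" for t
      using that
    proof (induction rule: span_induct)
      case base
      show ?case
        by (auto simp: subspace_def linear_0[OF linear_tensor_lift] linear_add[OF linear_tensor_lift]
            linear_cmul[OF linear_tensor_lift] module_hom_zero
            intro!: linear_compose_add linear_compose_scale_right)
    next
      case (step t)
      then obtain vs where "t = pure_tensor vs" by blast
      then have "?F t = (\<lambda>x. pure_tensor (us @ x # ws @ vs))"
        by (simp only: tensor_lift_pure[OF right]) simp
      then show ?case by (simp only: linear_pure_tensor)
    qed
    then show "linear (?F t)" by (simp only: span_pure_tensor UNIV_I)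
  qed
  show "pure_tensor us \<otimes>\<^sub>T pure_tensor vs = pure_tensor (us @ vs)"
    unfolding tensor_mult_def by (subst tensor_lift_pure[OF left], rule tensor_lift_pure[OF right])
  show "linear (\<lambda>s. s \<otimes>\<^sub>T t)"
    unfolding tensor_mult_def by (rule linear_tensor_lift)
  show "linear (\<lambda>t. s \<otimes>\<^sub>T t)"
  proof -
    have "s \<in> span (range pure_tensor)" by (simp add: span_pure_tensor)
    then show ?thesis
    proof (induction rule: span_induct)
      case base
      have lin: "linear (\<lambda>s. s \<otimes>\<^sub>T t)" for t :: "'a tensor"
        unfolding tensor_mult_def by (rule linear_tensor_lift)
      have "(\<otimes>\<^sub>T) 0 = (\<lambda>t :: 'a tensor. 0)"
        and "(\<otimes>\<^sub>T) (x + y) = (\<lambda>t. x \<otimes>\<^sub>T t + y \<otimes>\<^sub>T t)"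
        and "(\<otimes>\<^sub>T) (c *\<^sub>R x) = (\<lambda>t. c *\<^sub>R (x \<otimes>\<^sub>T t))" for x y :: "'a tensor" and c
        by (simp_all add: fun_eq_iff linear_0[OF lin] linear_add[OF lin] linear_cmul[OF lin])
      then show ?case
        by (simp add: subspace_def linear_zero linear_compose_add linear_compose_scale_right)
    next
      case (step s)
      then show ?case
        by (elim rangeE) (simp only: tensor_mult_def tensor_lift_pure[OF left] linear_tensor_lift)
    qed
  qed
qed

lemma tensor_permute_pure:
  assumes "\<rho> permutes {..<n}" "length vs = n"
  shows "tensor_permute n \<rho> (pure_tensor vs) = pure_tensor (permute_list \<rho> vs)"
proof -
  let ?f = "\<lambda>vs :: 'a list. pure_tensor (if length vs = n then permute_list \<rho> vs else vs)"
  have "linear (\<lambda>x. ?f (us @ x # ws))" for us ws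
  proof (cases "length (us @ 0 # ws) = n")
    case True
    define i where "i = inv \<rho> (length us)"
    define ys where "ys = permute_list \<rho> (us @ 0 # ws)"
    have i: "\<rho> i = length us" "i < n"
      using assms(1) True permutes_in_image[OF permutes_inv[OF assms(1)], of "length us"]
      by (auto simp: i_def permutes_inverses)
    have eq: "permute_list \<rho> (us @ x # ws) = ys[i := x]" for x
    proof (rule nth_equalityI)
      fix j assume "j < length (permute_list \<rho> (us @ x # ws))"
      then have j: "j < n" using True by simp
      moreover have "\<rho> j = length us \<longleftrightarrow> j = i"
        using i permutes_inj[OF assms(1)] by (metis injD)
      ultimately show "permute_list \<rho> (us @ x # ws) ! j = ys[i := x] ! j"
        using True i by (auto simp: ys_def permute_list_def nth_append nth_list_update nth_Cons')
    qed (use True in \<open>simp add: ys_def\<close>)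
    have "length ys = n" using True by (simp add: ys_def)
    then have "?f (us @ x # ws) = pure_tensor (take i ys @ x # drop (Suc i) ys)" for x
      using i True unfolding eq by (simp add: upd_conv_take_nth_drop)
    then show ?thesis by (simp only: linear_pure_tensor)
  next
    case False
    then show ?thesis by (auto simp: linear_pure_tensor)
  qed
  then have "multilinear ?f" by (simp add: multilinear_def)
  then show ?thesis
    using assms(2) by (simp add: tensor_permute_def tensor_lift_pure)
qed

lemma tensor_functional_pure:
  assumes "linear_on_power n \<phi>" "linear_on_power m \<sigma>" "length us = n" "length vs = m"
  shows "tensor_functional n m \<phi> \<sigma> (pure_tensor us \<otimes>\<^sub>T pure_tensor vs)
    = \<phi> (pure_tensor us) * \<sigma> (pure_tensor vs)"
proof -
  let ?f = "\<lambda>vs. if length vs = n + m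
      then \<phi> (pure_tensor (take n vs)) * \<sigma> (pure_tensor (drop n vs)) else 0"
  have lin: "linear (\<lambda>x. \<tau> (pure_tensor (us @ x # ws)))"
    if "linear_on_power p \<tau>" "Suc (length us + length ws) = p"
    for p \<tau> and us ws :: "'a list"
  proof -
    have "pure_tensor (us @ x # ws) \<in> tensor_power p" for x
      unfolding tensor_power_def using that(2) by (auto intro!: span_base)
    then show ?thesis
      using that(1)
      by (intro linearI) (simp_all add: linear_on_power_def linear_add[OF linear_pure_tensor]
          linear_cmul[OF linear_pure_tensor])
  qed
  have "linear (\<lambda>x. ?f (us @ x # ws))" for us ws
  proof (cases "length us + length ws + 1 = n + m")
    case len: True
    show ?thesis
    proof (cases "length us < n")
      case True
      obtain d where d: "n - length us = Suc d" using True by (metis Suc_diff_Suc)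
      have "linear (\<lambda>x. \<phi> (pure_tensor (us @ x # take d ws)))"
        by (rule lin[OF assms(1)]) (use len d in auto)
      from linear_compose_scale_right[OF this, of "\<sigma> (pure_tensor (drop d ws))"]
      show ?thesis using len d True by (simp add: mult.commute)
    next
      case False
      have "linear (\<lambda>x. \<sigma> (pure_tensor (drop n us @ x # ws)))"
        by (rule lin[OF assms(2)]) (use len False in auto)
      from linear_compose_scale_right[OF this, of "\<phi> (pure_tensor (take n us))"]
      show ?thesis using len False by simp
    qed
  next
    case False
    then show ?thesis by (simp add: linear_zero)
  qed
  then have "multilinear ?f" by (simp add: multilinear_def)
  then show ?thesis
    using assms(3,4) by (simp add: tensor_functional_def tensor_mult_pure tensor_lift_pure)
qed

section \<open>Admissible norms\<close>

text \<open>The operator norm is taken in the extended nonnegative reals: it is \<open>\<infinity>\<close> exactly for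
  unbounded maps, and \<open>0\<close> if the tensor power is trivial.\<close>

definition tensor_op_norm ::
  "(nat \<Rightarrow> 'v::real_vector tensor \<Rightarrow> real) \<Rightarrow> nat \<Rightarrow> ('v tensor \<Rightarrow> 'w::real_normed_vector) \<Rightarrow> ennreal"
where
  "tensor_op_norm nrm n A = (SUP t\<in>{t \<in> tensor_power n. nrm n t = 1}. ennreal (norm (A t)))"

definition tensor_dual ::
  "(nat \<Rightarrow> 'v::real_vector tensor \<Rightarrow> real) \<Rightarrow> nat \<Rightarrow> ('v tensor \<Rightarrow> real) set" where
  "tensor_dual nrm n = {\<phi>. linear_on_power n \<phi> \<and> tensor_op_norm nrm n \<phi> < \<infinity>}"

definition norm_on_power :: "nat \<Rightarrow> ('v::real_vector tensor \<Rightarrow> real) \<Rightarrow> bool" where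
  "norm_on_power n \<nu> \<longleftrightarrow>
    (\<forall>t\<in>tensor_power n. 0 \<le> \<nu> t \<and> (\<nu> t = 0 \<longleftrightarrow> t = 0)) \<and>
    (\<forall>c. \<forall>t\<in>tensor_power n. \<nu> (c *\<^sub>R t) = \<bar>c\<bar> * \<nu> t) \<and>
    (\<forall>s\<in>tensor_power n. \<forall>t\<in>tensor_power n. \<nu> (s + t) \<le> \<nu> s + \<nu> t)"

text \<open>Orders \<open>0\<close> and \<open>1\<close> carry the norms of \<open>\<real>\<close> and \<open>'v\<close> themselves.\<close>

definition admissible_norms :: "(nat \<Rightarrow> 'v::real_normed_vector tensor \<Rightarrow> real) \<Rightarrow> bool" where
  "admissible_norms nrm \<longleftrightarrow>
    (\<forall>c. nrm 0 (c *\<^sub>R pure_tensor []) = \<bar>c\<bar>) \<and>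
    (\<forall>v. nrm 1 (pure_tensor [v]) = norm v) \<and>
    (\<forall>n\<ge>2. norm_on_power n (nrm n)) \<and>
    (\<forall>n\<ge>1. \<forall>\<rho>. \<rho> permutes {..<n} \<longrightarrow>
      (\<forall>t\<in>tensor_power n. nrm n (tensor_permute n \<rho> t) = nrm n t)) \<and>
    (\<forall>n\<ge>1. \<forall>m\<ge>1. \<forall>s\<in>tensor_power n. \<forall>t\<in>tensor_power m.
      nrm (n + m) (s \<otimes>\<^sub>T t) \<le> nrm n s * nrm m t) \<and>
    (\<forall>n\<ge>1. \<forall>m\<ge>1. \<forall>\<phi>\<in>tensor_dual nrm n. \<forall>\<sigma>\<in>tensor_dual nrm m.
      tensor_op_norm nrm (n + m) (tensor_functional n m \<phi> \<sigma>)
        \<le> tensor_op_norm nrm n \<phi> * tensor_op_norm nrm m \<sigma>)"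

section \<open>Lipschitz functions in the sense of Stein\<close>

text \<open>For \<open>l = 0\<close> these are the maps \<open>c \<mapsto> c \<cdot> w\<close>, identified with \<open>w\<close>; the operator norm of such
  a map is \<open>norm w\<close>.\<close>

definition symmetric_forms :: "nat \<Rightarrow> ('v::real_vector tensor \<Rightarrow> 'w::real_vector) set" where
  "symmetric_forms l = {A. linear_on_power l A \<and>
    (\<forall>\<rho>. \<rho> permutes {..<l} \<longrightarrow> (\<forall>t\<in>tensor_power l. A (tensor_permute l \<rho> t) = A t))}"

definition lip_remainder ::
  "nat \<Rightarrow> (nat \<Rightarrow> 'v::real_vector \<Rightarrow> 'v tensor \<Rightarrow> 'w::real_vector) \<Rightarrow> nat \<Rightarrow> 'v \<Rightarrow> 'v
    \<Rightarrow> 'v tensor \<Rightarrow> 'w" where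
  "lip_remainder k \<psi> l x y t = \<psi> l y t -
    (\<Sum>s=0..k - l. (1 / fact s) *\<^sub>R \<psi> (l + s) x (t \<otimes>\<^sub>T pure_tensor (replicate s (y - x))))"

definition lip_bound ::
  "(nat \<Rightarrow> 'v::real_normed_vector tensor \<Rightarrow> real) \<Rightarrow> nat \<Rightarrow> real \<Rightarrow> 'v set
    \<Rightarrow> (nat \<Rightarrow> 'v \<Rightarrow> 'v tensor \<Rightarrow> 'w::real_normed_vector) \<Rightarrow> real \<Rightarrow> bool" where
  "lip_bound nrm k \<gamma> \<Sigma> \<psi> M \<longleftrightarrow> 0 \<le> M \<and>
    (\<forall>l\<in>{0..k}. \<forall>x\<in>\<Sigma>. \<forall>y\<in>\<Sigma>.
      tensor_op_norm nrm l (\<psi> l x) \<le> ennreal M \<and>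
      tensor_op_norm nrm l (lip_remainder k \<psi> l x y)
        \<le> ennreal (M * norm (y - x) powr (\<gamma> - real l)))"

definition lip_space ::
  "(nat \<Rightarrow> 'v::real_normed_vector tensor \<Rightarrow> real) \<Rightarrow> nat \<Rightarrow> real \<Rightarrow> 'v set
    \<Rightarrow> (nat \<Rightarrow> 'v \<Rightarrow> 'v tensor \<Rightarrow> 'w::real_normed_vector) set" where
  "lip_space nrm k \<gamma> \<Sigma> = {\<psi>.
    (\<forall>l\<in>{0..k}. \<forall>x\<in>\<Sigma>. \<psi> l x \<in> symmetric_forms l) \<and> (\<exists>M. lip_bound nrm k \<gamma> \<Sigma> \<psi> M)}"

definition lip_norm ::
  "(nat \<Rightarrow> 'v::real_normed_vector tensor \<Rightarrow> real) \<Rightarrow> nat \<Rightarrow> real \<Rightarrow> 'v set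
    \<Rightarrow> (nat \<Rightarrow> 'v \<Rightarrow> 'v tensor \<Rightarrow> 'w::real_normed_vector) \<Rightarrow> real" where
  "lip_norm nrm k \<gamma> \<Sigma> \<psi> = Inf {M. lip_bound nrm k \<gamma> \<Sigma> \<psi> M}"

lemma lip_bound_lip_norm:
  assumes "\<psi> \<in> lip_space nrm k \<gamma> \<Sigma>"
  shows "lip_bound nrm k \<gamma> \<Sigma> \<psi> (lip_norm nrm k \<gamma> \<Sigma> \<psi>)"
proof -
  define S where "S = {M. lip_bound nrm k \<gamma> \<Sigma> \<psi> M}"
  have ne: "S \<noteq> {}" and nonneg: "\<And>M. M \<in> S \<Longrightarrow> 0 \<le> M"
    using assms by (auto simp: S_def lip_space_def lip_bound_def)
  have key: "a \<le> ennreal (Inf S * c)" if a: "\<And>M. M \<in> S \<Longrightarrow> a \<le> ennreal (M * c)" and "0 \<le> c" for a c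
  proof (cases "c = 0")
    case True
    then show ?thesis using a ne by auto
  next
    case False
    with \<open>0 \<le> c\<close> have c: "c > 0" by simp
    have fin: "a < top" using a ne by (meson ennreal_less_top le_less_trans ex_in_conv)
    have "enn2real a / c \<le> M" if "M \<in> S" for M
      using enn2real_mono[OF a[OF that]] nonneg[OF that] c
      by (simp add: pos_divide_le_eq)
    then have "enn2real a / c \<le> Inf S" using ne by (intro cInf_greatest)
    then have "enn2real a \<le> Inf S * c" using c by (simp add: pos_divide_le_eq)
    then have "ennreal (enn2real a) \<le> ennreal (Inf S * c)" by (rule ennreal_leI)
    then show ?thesis using fin by simp
  qed
  have "0 \<le> Inf S" using ne nonneg by (intro cInf_greatest)
  moreover have "tensor_op_norm nrm l (\<psi> l x) \<le> ennreal (Inf S)"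
    and "tensor_op_norm nrm l (lip_remainder k \<psi> l x y)
      \<le> ennreal (Inf S * norm (y - x) powr (\<gamma> - real l))"
    if "l \<in> {0..k}" "x \<in> \<Sigma>" "y \<in> \<Sigma>" for l x y
    using that key[of "tensor_op_norm nrm l (\<psi> l x)" 1]
      key[of "tensor_op_norm nrm l (lip_remainder k \<psi> l x y)" "norm (y - x) powr (\<gamma> - real l)"]
    by (auto simp: S_def lip_bound_def)
  ultimately show ?thesis
    unfolding lip_norm_def S_def[symmetric] lip_bound_def by blast
qed

definition covering_number :: "'v::metric_space set \<Rightarrow> real \<Rightarrow> nat" where
  "covering_number \<Sigma> \<delta> =
    (LEAST d. \<exists>x. x ` {1..d} \<subseteq> \<Sigma> \<and> \<Sigma> \<subseteq> (\<Union>j\<in>{1..d}. cball (x j) \<delta>))"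

end

theory Submission
  imports Defs
begin

text \<open>
  Cover \<open>\<Sigma>\<close> by \<open>N\<close> balls of radius \<open>\<delta>\<^sub>0\<close>; minimality of \<open>N\<close> makes the centres distinct. For \<open>x\<close> in
  the ball around \<open>z\<close>, Taylor expansion at \<open>z\<close> writes \<open>\<psi>\<^sup>s(x) - \<phi>\<^sup>s(x)\<close> as a difference of remainders,
  bounded by \<open>(K\<^sub>1 + K\<^sub>2) \<parallel>x - z\<parallel>\<^bsup>\<gamma> - s\<^esup>\<close>, plus the expansion of \<open>\<psi>(z) - \<phi>(z)\<close>, bounded by
  \<open>\<epsilon>\<^sub>0 exp \<parallel>x - z\<parallel>\<close>. The inequality defining \<open>\<delta>\<^sub>0\<close> forces \<open>\<delta>\<^sub>0 \<le> 1\<close>, so that lowering the exponent from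
  \<open>\<gamma> - s\<close> to \<open>\<gamma> - l\<close> only increases the bound, and by continuity \<open>\<delta>\<^sub>0\<close> itself satisfies that inequality.
\<close>

section \<open>Norms on tensor powers\<close>

lemma tensor_power_0: "tensor_power 0 = range (\<lambda>c. c *\<^sub>R pure_tensor [])"
  by (simp add: tensor_power_def span_singleton)

lemma tensor_power_1: "tensor_power 1 = range (\<lambda>v. pure_tensor [v])"
proof -
  have lin: "linear (\<lambda>v :: 'a. pure_tensor [v])"
    using linear_pure_tensor[of "[]" "[]"] by simp
  have "pure_tensor ` {vs :: 'a list. length vs = 1} = range (\<lambda>v. pure_tensor [v])"
    by (auto simp: length_Suc_conv image_iff)
  then show ?thesis
    by (simp add: tensor_power_def linear_span_image[OF lin])
qed

lemma pure_tensor_in_power: "length vs = n \<Longrightarrow> pure_tensor vs \<in> tensor_power n"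
  by (auto simp: tensor_power_def intro: span_base)

lemma zero_in_power: "0 \<in> tensor_power n"
  by (simp add: tensor_power_def span_zero)

lemma scale_in_power: "t \<in> tensor_power n \<Longrightarrow> c *\<^sub>R t \<in> tensor_power n"
  by (simp add: tensor_power_def span_scale)

lemma tensor_mult_unit_right: "t \<otimes>\<^sub>T pure_tensor [] = t"
proof -
  have "t \<in> span (range pure_tensor)" by (simp add: span_pure_tensor)
  then show ?thesis
    by (induction rule: span_induct)
      (auto simp: subspace_def tensor_mult_pure linear_0[OF linear_tensor_mult_left]
        linear_add[OF linear_tensor_mult_left] linear_cmul[OF linear_tensor_mult_left])
qed

text \<open>Bilinearity reduces the claim to pure tensors by one span induction in each factor, and
  there the word lengths add under concatenation.\<close>

lemma tensor_mult_in_power: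
  assumes "s \<in> tensor_power n" "t \<in> tensor_power m"
  shows "s \<otimes>\<^sub>T t \<in> tensor_power (n + m)"
proof -
  have sub: "subspace (tensor_power p)" for p
    by (simp add: tensor_power_def)
  have *: "pure_tensor us \<otimes>\<^sub>T t \<in> tensor_power (n + m)" if "length us = n" for us
    using assms(2) unfolding tensor_power_def[of m]
  proof (induction rule: span_induct)
    case base
    show ?case
      using subspace_0[OF sub] subspace_add[OF sub] subspace_scale[OF sub]
      by (auto simp: subspace_def linear_0[OF linear_tensor_mult_right]
        linear_add[OF linear_tensor_mult_right] linear_cmul[OF linear_tensor_mult_right])
  next
    case (step t)
    then show ?case
      using that by (auto simp: tensor_mult_pure intro!: pure_tensor_in_power)
  qed
  show ?thesis
    using assms(1) unfolding tensor_power_def[of n]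
  proof (induction rule: span_induct)
    case base
    show ?case
      using subspace_0[OF sub] subspace_add[OF sub] subspace_scale[OF sub]
      by (auto simp: subspace_def linear_0[OF linear_tensor_mult_left]
        linear_add[OF linear_tensor_mult_left] linear_cmul[OF linear_tensor_mult_left])
  next
    case (step t)
    then show ?case using * by auto
  qed
qed

text \<open>\<open>admissible_norms\<close> asks for the norm axioms only from order 2 on. In orders
  0 and 1 every element is a multiple of the empty word or a one-letter word, so the axioms are
  inherited from the reals and from the base space.\<close>

lemma admissible_norm_on_power:
  assumes "admissible_norms nrm"
  shows "norm_on_power n (nrm n)"
proof -
  have nrm0: "nrm 0 (c *\<^sub>R pure_tensor []) = \<bar>c\<bar>" for c
    using assms by (simp add: admissible_norms_def)
  have nrm1: "nrm 1 (pure_tensor [v]) = norm v" for v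
    using assms by (simp add: admissible_norms_def)
  have lin: "linear (\<lambda>v :: 'a. pure_tensor [v])"
    using linear_pure_tensor[of "[]" "[]"] by simp
  consider "n = 0" | "n = 1" | "n \<ge> 2" by linarith
  then show ?thesis
  proof cases
    case 1
    have "nrm 0 0 = 0" using nrm0[of 0] by simp
    moreover have "nrm 0 (a *\<^sub>R b *\<^sub>R pure_tensor []) = \<bar>a\<bar> * \<bar>b\<bar>"
      and "nrm 0 (a *\<^sub>R pure_tensor [] + b *\<^sub>R pure_tensor []) = \<bar>a + b\<bar>"
      and "a *\<^sub>R pure_tensor [] = (0 :: 'a tensor) \<longleftrightarrow> a = 0" for a b
      using nrm0[of "a * b"] nrm0[of "a + b"] nrm0[of a] \<open>nrm 0 0 = 0\<close>
      by (auto simp: scaleR_left_distrib abs_mult)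
    ultimately show ?thesis
      unfolding norm_on_power_def 1 tensor_power_0
      by (simp add: nrm0 abs_triangle_ineq del: scaleR_eq_0_iff scaleR_scaleR)
  next
    case 2
    have zero: "pure_tensor [0] = (0 :: 'a tensor)"
      using linear_0[OF lin] .
    then have "nrm 1 0 = 0" using nrm1[of 0] by simp
    \<comment> \<open>Definiteness needs one-letter words to be classes of nonzero tensors unless
      the letter is 0. The prescribed value \<open>norm v\<close> shows this without any analysis of
      the quotient.\<close>
    then have "pure_tensor [v] = (0 :: 'a tensor) \<longleftrightarrow> v = 0" for v
      using nrm1[of v] zero by auto
    moreover have "nrm 1 (c *\<^sub>R pure_tensor [v]) = \<bar>c\<bar> * norm v"
      and "nrm 1 (pure_tensor [v] + pure_tensor [w]) = norm (v + w)" for c v w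
      using nrm1[of "c *\<^sub>R v"] nrm1[of "v + w"]
      by (simp_all add: linear_cmul[OF lin] linear_add[OF lin])
    ultimately show ?thesis
      unfolding norm_on_power_def 2 tensor_power_1
      using nrm1 by (simp add: norm_triangle_ineq)
  next
    case 3
    then show ?thesis using assms by (simp add: admissible_norms_def)
  qed
qed

lemma admissible_norm_mult:
  assumes "admissible_norms nrm" "n \<ge> 1" "m \<ge> 1" "s \<in> tensor_power n" "t \<in> tensor_power m"
  shows "nrm (n + m) (s \<otimes>\<^sub>T t) \<le> nrm n s * nrm m t"
  using assms unfolding admissible_norms_def by blast

text \<open>Submultiplicativity is available only in positive orders, so peeling off one letter
  works for \<open>n > 0\<close>, while order 1 is read off directly from the norm of the base
  space.\<close>

lemma admissible_norm_replicate:
  assumes "admissible_norms nrm"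
  shows "nrm n (pure_tensor (replicate n v)) \<le> norm v ^ n"
proof (induction n)
  case 0
  have "nrm 0 (1 *\<^sub>R pure_tensor []) = \<bar>1\<bar>"
    using assms unfolding admissible_norms_def by blast
  then show ?case by simp
next
  case (Suc n)
  have 1: "nrm 1 (pure_tensor [v]) = norm v"
    using assms by (simp add: admissible_norms_def)
  show ?case
  proof (cases "n = 0")
    case True
    then show ?thesis using 1 by simp
  next
    case False
    have "nrm (1 + n) (pure_tensor [v] \<otimes>\<^sub>T pure_tensor (replicate n v))
        \<le> nrm 1 (pure_tensor [v]) * nrm n (pure_tensor (replicate n v))"
      using False by (intro admissible_norm_mult[OF assms] pure_tensor_in_power) auto
    also have "\<dots> \<le> norm v * norm v ^ n"
      using Suc 1 by (simp add: mult_left_mono)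
    finally show ?thesis by (simp add: tensor_mult_pure)
  qed
qed

text \<open>This bounds the arguments of the Taylor terms. A factor of order 0 lies outside the
  submultiplicativity axiom and is treated as a scalar: \<open>n = 0\<close> uses homogeneity,
  \<open>i = 0\<close> the unit law.\<close>

lemma admissible_norm_mult_replicate:
  assumes "admissible_norms nrm" "t \<in> tensor_power n"
  shows "nrm (n + i) (t \<otimes>\<^sub>T pure_tensor (replicate i v)) \<le> nrm n t * norm v ^ i"
proof -
  have rep: "pure_tensor (replicate i v) \<in> tensor_power i"
    by (simp add: pure_tensor_in_power)
  have nonneg: "0 \<le> nrm n t"
    using admissible_norm_on_power[OF assms(1), of n] assms(2) by (simp add: norm_on_power_def)
  have "nrm (n + i) (t \<otimes>\<^sub>T pure_tensor (replicate i v))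
      \<le> nrm n t * nrm i (pure_tensor (replicate i v))"
  proof (cases "n = 0")
    case True
    then obtain c where c: "t = c *\<^sub>R pure_tensor []"
      using assms(2) by (auto simp: tensor_power_0)
    then have "t \<otimes>\<^sub>T pure_tensor (replicate i v) = c *\<^sub>R pure_tensor (replicate i v)"
      by (simp add: linear_cmul[OF linear_tensor_mult_left] tensor_mult_pure)
    moreover have "nrm i (c *\<^sub>R pure_tensor (replicate i v)) = \<bar>c\<bar> * nrm i (pure_tensor (replicate i v))"
      using admissible_norm_on_power[OF assms(1), of i] rep by (simp add: norm_on_power_def)
    moreover have "nrm 0 t = \<bar>c\<bar>"
      using assms(1) c by (simp add: admissible_norms_def)
    ultimately show ?thesis using True by simp
  next
    case n: False
    show ?thesis
    proof (cases "i = 0")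
      case True
      have "nrm 0 (1 *\<^sub>R pure_tensor []) = \<bar>1\<bar>"
        using assms(1) unfolding admissible_norms_def by blast
      then show ?thesis using True by (simp add: tensor_mult_unit_right)
    next
      case False
      then show ?thesis
        using assms n rep by (intro admissible_norm_mult) auto
    qed
  qed
  also have "\<dots> \<le> nrm n t * norm v ^ i"
    using nonneg admissible_norm_replicate[OF assms(1)] by (simp add: mult_left_mono)
  finally show ?thesis .
qed

section \<open>Operator norms as pointwise bounds\<close>

lemma tensor_op_norm_leD:
  assumes "tensor_op_norm nrm n A \<le> ennreal M" "0 \<le> M" "t \<in> tensor_power n" "nrm n t = 1"
  shows "norm (A t) \<le> M"
proof -
  have "ennreal (norm (A t)) \<le> tensor_op_norm nrm n A"
    unfolding tensor_op_norm_def by (rule SUP_upper) (use assms in simp)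
  then show ?thesis
    using assms(1,2) by (metis ennreal_le_iff order_trans)
qed

text \<open>The operator norm only sees unit tensors, so a nonzero \<open>t\<close> is rescaled to
  norm 1; this is where linearity of \<open>A\<close> enters.\<close>

lemma tensor_op_norm_bound:
  assumes "norm_on_power n (nrm n)" "linear_on_power n A"
    and "tensor_op_norm nrm n A \<le> ennreal M" "0 \<le> M" "t \<in> tensor_power n"
  shows "norm (A t) \<le> M * nrm n t"
proof (cases "t = 0")
  case True
  have "A 0 = 0"
    using assms(2) zero_in_power[of n] unfolding linear_on_power_def by (metis scaleR_zero_left)
  moreover have "nrm n 0 = 0"
    using assms(1) zero_in_power[of n] by (auto simp: norm_on_power_def)
  ultimately show ?thesis using True by simp
next
  case False
  then have pos: "nrm n t > 0"
    using assms(1,5) by (auto simp: norm_on_power_def less_le)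
  define u where "u = (1 / nrm n t) *\<^sub>R t"
  have "u \<in> tensor_power n" "nrm n u = 1"
    using assms(1,5) pos by (auto simp: u_def norm_on_power_def scale_in_power)
  then have "norm (A u) \<le> M"
    using assms(3,4) by (intro tensor_op_norm_leD[of nrm n])
  moreover have "A u = (1 / nrm n t) *\<^sub>R A t"
    using assms(2,5) by (simp add: u_def linear_on_power_def)
  ultimately show ?thesis
    using pos by (simp add: pos_divide_le_eq)
qed

section \<open>Pointwise estimates for Lipschitz functions\<close>

lemma sum_power_fact_le_exp:
  assumes "0 \<le> (d :: real)"
  shows "(\<Sum>i=0..n. d ^ i / fact i) \<le> exp d"
proof -
  have "(\<lambda>i. d ^ i / fact i) sums exp d"
    using exp_converges[of d] by (simp add: field_simps)
  then show ?thesis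
    using assms sum_le_suminf[of "\<lambda>i. d ^ i / fact i" "{0..n}"]
    by (simp add: sums_iff)
qed

lemma lip_bound_mono:
  assumes "lip_bound nrm k \<gamma> \<Sigma> \<psi> M" "M \<le> K"
  shows "lip_bound nrm k \<gamma> \<Sigma> \<psi> K"
  using assms unfolding lip_bound_def
  by (meson ennreal_leI mult_right_mono order_trans powr_ge_zero)

text \<open>Closeness at \<open>z\<close> is assumed in every order up to \<open>k\<close> because
  the expansion of order \<open>s\<close> around \<open>z\<close> involves all the orders from
  \<open>s\<close> to \<open>k\<close>.\<close>

lemma lip_bound_diff_estimate:
  assumes adm: "admissible_norms nrm"
    and \<psi>: "\<psi> \<in> lip_space nrm k \<gamma> \<Sigma>" "lip_bound nrm k \<gamma> \<Sigma> \<psi> K\<^sub>1"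
    and \<phi>: "\<phi> \<in> lip_space nrm k \<gamma> \<Sigma>" "lip_bound nrm k \<gamma> \<Sigma> \<phi> K\<^sub>2"
    and z: "z \<in> \<Sigma>" and x: "x \<in> \<Sigma>" and "s \<le> k" "0 \<le> \<epsilon>\<^sub>0"
    and close: "\<And>i. i \<le> k \<Longrightarrow> tensor_op_norm nrm i (\<lambda>t. \<psi> i z t - \<phi> i z t) \<le> ennreal \<epsilon>\<^sub>0"
  shows "tensor_op_norm nrm s (\<lambda>t. \<psi> s x t - \<phi> s x t)
    \<le> ennreal ((K\<^sub>1 + K\<^sub>2) * norm (x - z) powr (\<gamma> - real s) + \<epsilon>\<^sub>0 * exp (norm (x - z)))"
  unfolding tensor_op_norm_def
proof (rule SUP_least, elim CollectE conjE)
  fix t assume t: "t \<in> tensor_power s" "nrm s t = 1"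
  define d where "d = norm (x - z)"
  define u where "u i = t \<otimes>\<^sub>T pure_tensor (replicate i (x - z))" for i
  define D where "D i t = \<psi> i z t - \<phi> i z t" for i t
  have rem: "norm (lip_remainder k f s z x t) \<le> K * d powr (\<gamma> - real s)"
    if "lip_bound nrm k \<gamma> \<Sigma> f K" for f :: "nat \<Rightarrow> 'a \<Rightarrow> 'a tensor \<Rightarrow> 'b" and K
    using that x z \<open>s \<le> k\<close> t
    by (intro tensor_op_norm_leD[of nrm s]) (auto simp: lip_bound_def d_def)
  \<comment> \<open>Unlike \<open>t\<close>, the tensor \<open>u i\<close> need not have norm 1, so
    this bound goes through linearity of \<open>D (s + i)\<close> and the estimate of the norm of
    \<open>u i\<close> by \<open>d ^ i\<close>.\<close>
  have D: "norm (D (s + i) (u i)) \<le> \<epsilon>\<^sub>0 * d ^ i" if "i \<in> {0..k - s}" for i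
  proof -
    have le: "s + i \<le> k" using that \<open>s \<le> k\<close> by simp
    have u: "u i \<in> tensor_power (s + i)"
      unfolding u_def by (intro tensor_mult_in_power t pure_tensor_in_power) simp
    have "linear_on_power (s + i) (\<psi> (s + i) z)" "linear_on_power (s + i) (\<phi> (s + i) z)"
      using \<psi>(1) \<phi>(1) z le by (auto simp: lip_space_def symmetric_forms_def)
    then have "linear_on_power (s + i) (D (s + i))"
      by (auto simp: linear_on_power_def D_def scaleR_diff_right)
    then have "norm (D (s + i) (u i)) \<le> \<epsilon>\<^sub>0 * nrm (s + i) (u i)"
      using close[OF le] \<open>0 \<le> \<epsilon>\<^sub>0\<close> u
      by (intro tensor_op_norm_bound admissible_norm_on_power[OF adm]) (simp_all add: D_def[abs_def])
    also have "\<dots> \<le> \<epsilon>\<^sub>0 * d ^ i"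
      using admissible_norm_mult_replicate[OF adm t(1), of i "x - z"] t(2) \<open>0 \<le> \<epsilon>\<^sub>0\<close>
      by (simp add: u_def d_def mult_left_mono)
    finally show ?thesis .
  qed
  have "norm (\<Sum>i=0..k - s. (1 / fact i) *\<^sub>R D (s + i) (u i)) \<le> (\<Sum>i=0..k - s. \<epsilon>\<^sub>0 * (d ^ i / fact i))"
    by (rule sum_norm_le) (use D in \<open>auto simp: divide_right_mono\<close>)
  also have "\<dots> \<le> \<epsilon>\<^sub>0 * exp d"
    unfolding sum_distrib_left[symmetric]
    using \<open>0 \<le> \<epsilon>\<^sub>0\<close> by (intro mult_left_mono sum_power_fact_le_exp) (simp_all add: d_def)
  finally have sum: "norm (\<Sum>i=0..k - s. (1 / fact i) *\<^sub>R D (s + i) (u i)) \<le> \<epsilon>\<^sub>0 * exp d" .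
  \<comment> \<open>Solving the definition of the remainder for the value at \<open>x\<close> and
    subtracting the two expansions merges their Taylor sums into one in \<open>D\<close>.\<close>
  have "\<psi> s x t - \<phi> s x t = lip_remainder k \<psi> s z x t - lip_remainder k \<phi> s z x t
      + (\<Sum>i=0..k - s. (1 / fact i) *\<^sub>R D (s + i) (u i))"
    by (simp add: lip_remainder_def D_def u_def scaleR_diff_right sum_subtractf)
  then have "norm (\<psi> s x t - \<phi> s x t) \<le> norm (lip_remainder k \<psi> s z x t)
      + norm (lip_remainder k \<phi> s z x t) + norm (\<Sum>i=0..k - s. (1 / fact i) *\<^sub>R D (s + i) (u i))"
    using norm_triangle_ineq4[of "lip_remainder k \<psi> s z x t" "lip_remainder k \<phi> s z x t"]
    by (simp add: norm_triangle_le)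
  also have "\<dots> \<le> (K\<^sub>1 + K\<^sub>2) * d powr (\<gamma> - real s) + \<epsilon>\<^sub>0 * exp d"
    using rem[OF \<psi>(2)] rem[OF \<phi>(2)] sum by (simp add: algebra_simps)
  finally show "ennreal (norm (\<psi> s x t - \<phi> s x t))
      \<le> ennreal ((K\<^sub>1 + K\<^sub>2) * norm (x - z) powr (\<gamma> - real s) + \<epsilon>\<^sub>0 * exp (norm (x - z)))"
    unfolding d_def by (rule ennreal_leI)
qed

section \<open>The covering and the critical radius\<close>

text \<open>Compactness gives total boundedness, hence some finite cover, so the
  \<open>LEAST\<close> in the definition is a genuine minimum.\<close>

lemma covering_number_attained:
  fixes \<Sigma> :: "'a::metric_space set"
  assumes "compact \<Sigma>" "\<delta> > 0"
  obtains z where "inj_on z {1..covering_number \<Sigma> \<delta>}" "z ` {1..covering_number \<Sigma> \<delta>} \<subseteq> \<Sigma>"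
    "\<Sigma> \<subseteq> (\<Union>j\<in>{1..covering_number \<Sigma> \<delta>}. cball (z j) \<delta>)"
proof -
  let ?P = "\<lambda>d. \<exists>x. x ` {1..d} \<subseteq> \<Sigma> \<and> \<Sigma> \<subseteq> (\<Union>j\<in>{1..d}. cball (x j) \<delta>)"
  have P_card: "?P (card F)" if "finite F" "F \<subseteq> \<Sigma>" "\<Sigma> \<subseteq> (\<Union>y\<in>F. cball y \<delta>)" for F
  proof -
    obtain h where "bij_betw h {1..card F} F"
      using ex_bij_betw_nat_finite_1[OF \<open>finite F\<close>] by blast
    then have "h ` {1..card F} = F" by (rule bij_betw_imp_surj_on)
    then have "h ` {1..card F} \<subseteq> \<Sigma> \<and> \<Sigma> \<subseteq> (\<Union>y\<in>h ` {1..card F}. cball y \<delta>)"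
      using that by simp
    then show ?thesis by (intro exI[of _ h]) simp
  qed
  obtain F where "finite F" "F \<subseteq> \<Sigma>" "\<Sigma> \<subseteq> (\<Union>y\<in>F. ball y \<delta>)"
    using compact_imp_seq_compact[OF assms(1)] seq_compact_imp_totally_bounded assms(2) by metis
  moreover have "(\<Union>y\<in>F. ball y \<delta>) \<subseteq> (\<Union>y\<in>F. cball y \<delta>)"
    by (intro UN_mono ball_subset_cball order_refl)
  ultimately have "?P (card F)"
    by (blast intro: P_card order_trans)
  then have "?P (covering_number \<Sigma> \<delta>)"
    unfolding covering_number_def by (rule LeastI)
  then obtain z where z: "z ` {1..covering_number \<Sigma> \<delta>} \<subseteq> \<Sigma>"
    "\<Sigma> \<subseteq> (\<Union>j\<in>{1..covering_number \<Sigma> \<delta>}. cball (z j) \<delta>)" by blast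
  \<comment> \<open>Coinciding centres would leave a cover by fewer balls. Counting the image of
    \<open>z\<close> as a cover in its own right therefore bounds its cardinality below by the
    covering number.\<close>
  then have "?P (card (z ` {1..covering_number \<Sigma> \<delta>}))"
    by (intro P_card) auto
  then have "covering_number \<Sigma> \<delta> \<le> card (z ` {1..covering_number \<Sigma> \<delta>})"
    unfolding covering_number_def by (rule Least_le)
  moreover have "card (z ` {1..covering_number \<Sigma> \<delta>}) \<le> covering_number \<Sigma> \<delta>"
    using card_image_le[of "{1..covering_number \<Sigma> \<delta>}" z] by simp
  ultimately have "inj_on z {1..covering_number \<Sigma> \<delta>}"
    by (intro eq_card_imp_inj_on) auto
  then show ?thesis using that z by blast
qed

lemma critical_radius:
  fixes K m \<epsilon>\<^sub>0 a :: real
  defines "S \<equiv> {\<theta>. \<theta> > 0 \<and> K * \<theta> powr a + \<epsilon>\<^sub>0 * exp \<theta> \<le> m}"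
  assumes "K > 0" "a > 0" "0 \<le> \<epsilon>\<^sub>0" "\<epsilon>\<^sub>0 < m" "m \<le> K"
  shows "0 < Sup S" "Sup S \<le> 1" "K * Sup S powr a + \<epsilon>\<^sub>0 * exp (Sup S) \<le> m"
proof -
  let ?f = "\<lambda>\<theta>. K * \<theta> powr a + \<epsilon>\<^sub>0 * exp \<theta>"
  \<comment> \<open>For \<open>\<theta> > 1\<close> the first summand alone exceeds
    \<open>K\<close>, which is at least \<open>m\<close>.\<close>
  have le1: "\<theta> \<le> 1" if "\<theta> \<in> S" for \<theta>
  proof (rule ccontr)
    assume "\<not> \<theta> \<le> 1"
    then have "\<theta> powr a > 1" using \<open>a > 0\<close> by (simp add: gr_one_powr)
    then have "K * \<theta> powr a > K" using \<open>K > 0\<close> by simp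
    moreover have "\<epsilon>\<^sub>0 * exp \<theta> \<ge> 0" using \<open>0 \<le> \<epsilon>\<^sub>0\<close> by simp
    ultimately show False using that \<open>m \<le> K\<close> by (simp add: S_def)
  qed
  then have bdd: "bdd_above S" by (rule bdd_aboveI)
  \<comment> \<open>The positive exponent gives continuity up to 0, where \<open>?f\<close> equals
    \<open>\<epsilon>\<^sub>0 < m\<close>. Hence all small positive radii belong to
    \<open>S\<close>.\<close>
  have cont: "continuous_on {0..} ?f"
    using \<open>a > 0\<close> by (intro continuous_intros continuous_on_powr') auto
  then have "(?f \<longlongrightarrow> ?f 0) (at 0 within {0..})"
    unfolding continuous_on_def by (rule bspec) simp
  then have "(?f \<longlongrightarrow> ?f 0) (at_right 0)"
    by (rule tendsto_within_subset) auto
  then have "eventually (\<lambda>\<theta>. ?f \<theta> < m) (at_right 0)"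
    using \<open>\<epsilon>\<^sub>0 < m\<close> by (intro order_tendstoD) auto
  then have "eventually (\<lambda>\<theta>. \<theta> \<in> S) (at_right 0)"
    using eventually_at_right_less[of 0] by eventually_elim (auto simp: S_def)
  then obtain \<theta> where \<theta>: "\<theta> \<in> S"
    using eventually_happens'[OF trivial_limit_at_right_real] by blast
  then have ne: "S \<noteq> {}" by blast
  have "0 < \<theta>" using \<theta> by (simp add: S_def)
  also have "\<theta> \<le> Sup S" using \<theta> bdd by (rule cSup_upper)
  finally show "0 < Sup S" .
  show "Sup S \<le> 1" using ne le1 by (rule cSup_least)
  \<comment> \<open>\<open>S\<close> excludes 0, so the supremum is located in this larger sublevel
    set, whose closedness follows from continuity on \<open>{0..}\<close>.\<close>
  have "closed {\<theta> \<in> {0..}. ?f \<theta> \<le> m}"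
    by (intro continuous_on_closed_Collect_le cont continuous_on_const closed_atLeast)
  moreover have "S \<subseteq> {\<theta> \<in> {0..}. ?f \<theta> \<le> m}" by (auto simp: S_def)
  ultimately have "Sup S \<in> {\<theta> \<in> {0..}. ?f \<theta> \<le> m}"
    using closure_contains_Sup[OF ne bdd] closure_minimal by blast
  then show "?f (Sup S) \<le> m" by simp
qed

section \<open>From closeness at the centres to closeness on all of \<Sigma>\<close>

theorem corollary4p5:
  fixes nrm :: "nat \<Rightarrow> 'v::banach tensor \<Rightarrow> real"
    and \<Sigma> :: "'v set"
    and \<epsilon> \<epsilon>\<^sub>0 \<gamma> K\<^sub>1 K\<^sub>2 \<delta>\<^sub>0 :: real
    and k l N :: nat
  assumes "admissible_norms nrm"
    and "compact \<Sigma>"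
    and "\<epsilon> > 0" and "\<gamma> > 0"
    and "real k < \<gamma>" and "\<gamma> \<le> real k + 1"
    and "K\<^sub>1 \<ge> 0" and "K\<^sub>2 \<ge> 0" and "(K\<^sub>1, K\<^sub>2) \<noteq> (0, 0)"
    and "0 \<le> \<epsilon>\<^sub>0" and "\<epsilon>\<^sub>0 < min (K\<^sub>1 + K\<^sub>2) \<epsilon>"
    and "l \<in> {0..k}"
    and "\<delta>\<^sub>0 = Sup {\<theta>. \<theta> > 0 \<and>
           (K\<^sub>1 + K\<^sub>2) * \<theta> powr (\<gamma> - real l) + \<epsilon>\<^sub>0 * exp \<theta> \<le> min (K\<^sub>1 + K\<^sub>2) \<epsilon>}"
    and "N = covering_number \<Sigma> \<delta>\<^sub>0"
  shows "\<exists>\<Sigma>\<^sub>N z. \<Sigma>\<^sub>N \<subseteq> \<Sigma> \<and> bij_betw z {1..N} \<Sigma>\<^sub>N \<and>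
    (\<forall>\<psi> \<phi> :: nat \<Rightarrow> 'v \<Rightarrow> 'v tensor \<Rightarrow> 'w::banach.
      \<psi> \<in> lip_space nrm k \<gamma> \<Sigma> \<longrightarrow> \<phi> \<in> lip_space nrm k \<gamma> \<Sigma> \<longrightarrow>
      lip_norm nrm k \<gamma> \<Sigma> \<psi> \<le> K\<^sub>1 \<longrightarrow> lip_norm nrm k \<gamma> \<Sigma> \<phi> \<le> K\<^sub>2 \<longrightarrow>
      (\<forall>i\<in>{0..k}. \<forall>j\<in>{1..N}.
        tensor_op_norm nrm i (\<lambda>t. \<psi> i (z j) t - \<phi> i (z j) t) \<le> ennreal \<epsilon>\<^sub>0) \<longrightarrow>
      (\<forall>s\<in>{0..l}. \<forall>x\<in>\<Sigma>.
        tensor_op_norm nrm s (\<lambda>t. \<psi> s x t - \<phi> s x t) \<le> ennreal \<epsilon>))"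
proof -
  let ?m = "min (K\<^sub>1 + K\<^sub>2) \<epsilon>"
  have K: "K\<^sub>1 + K\<^sub>2 > 0"
    using assms(7-9) by (auto simp: less_le add_nonneg_eq_0_iff)
  have "\<gamma> - real l > 0" "l \<le> k"
    using assms(5,12) by auto
  then have \<delta>: "0 < \<delta>\<^sub>0" "\<delta>\<^sub>0 \<le> 1"
    "(K\<^sub>1 + K\<^sub>2) * \<delta>\<^sub>0 powr (\<gamma> - real l) + \<epsilon>\<^sub>0 * exp \<delta>\<^sub>0 \<le> ?m"
    unfolding assms(13)
    using K assms(10,11) critical_radius[of "K\<^sub>1 + K\<^sub>2" "\<gamma> - real l" \<epsilon>\<^sub>0 ?m] by simp_all
  \<comment> \<open>The centres are fixed before \<open>\<psi>\<close> and \<open>\<phi>\<close> are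
    introduced, so the same points serve every pair.\<close>
  obtain z where z: "inj_on z {1..N}" "z ` {1..N} \<subseteq> \<Sigma>" "\<Sigma> \<subseteq> (\<Union>j\<in>{1..N}. cball (z j) \<delta>\<^sub>0)"
    unfolding assms(14) using covering_number_attained[OF assms(2) \<delta>(1)] .
  have "tensor_op_norm nrm s (\<lambda>t. \<psi> s x t - \<phi> s x t) \<le> ennreal \<epsilon>"
    if \<psi>: "\<psi> \<in> lip_space nrm k \<gamma> \<Sigma>" "lip_norm nrm k \<gamma> \<Sigma> \<psi> \<le> K\<^sub>1"
      and \<phi>: "\<phi> \<in> lip_space nrm k \<gamma> \<Sigma>" "lip_norm nrm k \<gamma> \<Sigma> \<phi> \<le> K\<^sub>2"
      and close: "\<forall>i\<in>{0..k}. \<forall>j\<in>{1..N}.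
        tensor_op_norm nrm i (\<lambda>t. \<psi> i (z j) t - \<phi> i (z j) t) \<le> ennreal \<epsilon>\<^sub>0"
      and s: "s \<in> {0..l}" and x: "x \<in> \<Sigma>"
    for \<psi> \<phi> :: "nat \<Rightarrow> 'v \<Rightarrow> 'v tensor \<Rightarrow> 'w" and s x
  proof -
    obtain j where j: "j \<in> {1..N}" "norm (x - z j) \<le> \<delta>\<^sub>0"
      using z(3) x by (auto simp: dist_norm norm_minus_commute)
    define d where "d = norm (x - z j)"
    have "tensor_op_norm nrm s (\<lambda>t. \<psi> s x t - \<phi> s x t)
        \<le> ennreal ((K\<^sub>1 + K\<^sub>2) * d powr (\<gamma> - real s) + \<epsilon>\<^sub>0 * exp d)"
      unfolding d_def
      using lip_bound_mono[OF lip_bound_lip_norm[OF \<psi>(1)] \<psi>(2)]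
        lip_bound_mono[OF lip_bound_lip_norm[OF \<phi>(1)] \<phi>(2)] z(2) j(1) x s \<open>l \<le> k\<close> close assms(10)
      by (intro lip_bound_diff_estimate[OF assms(1) \<psi>(1) _ \<phi>(1)]) auto
    also have "\<dots> \<le> ennreal \<epsilon>"
    proof (rule ennreal_leI)
      have d: "0 \<le> d" "d \<le> \<delta>\<^sub>0" using j(2) by (simp_all add: d_def)
      \<comment> \<open>Since \<open>s \<le> l\<close>, the exponent drops, and a base in the unit
        interval makes the power grow. The next step enlarges the base to
        \<open>\<delta>\<^sub>0\<close>, using that \<open>\<gamma> - real l\<close> is
        positive.\<close>
      have "d powr (\<gamma> - real s) \<le> d powr (\<gamma> - real l)"
        using d \<delta>(2) s by (intro powr_mono') auto
      also have "\<dots> \<le> \<delta>\<^sub>0 powr (\<gamma> - real l)"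
        using d \<open>\<gamma> - real l > 0\<close> by (intro powr_mono2) auto
      finally have "(K\<^sub>1 + K\<^sub>2) * d powr (\<gamma> - real s) \<le> (K\<^sub>1 + K\<^sub>2) * \<delta>\<^sub>0 powr (\<gamma> - real l)"
        using K by simp
      moreover have "\<epsilon>\<^sub>0 * exp d \<le> \<epsilon>\<^sub>0 * exp \<delta>\<^sub>0"
        using d assms(10) by (simp add: mult_left_mono)
      ultimately show "(K\<^sub>1 + K\<^sub>2) * d powr (\<gamma> - real s) + \<epsilon>\<^sub>0 * exp d \<le> \<epsilon>"
        using \<delta>(3) by linarith
    qed
    finally show ?thesis .
  qed
  then show ?thesis
    using z(1,2) by (intro exI[of _ "z ` {1..N}"] exI[of _ z]) (simp add: inj_on_imp_bij_betw)
qed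

end
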